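(* Let $\rho_1,\rho_2\ge0$ and let $\Delta_1,\Delta_2$ be IID real random variables with mean zero, finite variance and pdf $f_\Delta$. Consider the two-slot problem of minimizing, over admissible policies $\pi=\{(G_i,C_i,D_i): i=1,2\}$, $$\mathbb{E}\Big[\sum_{i=1}^2\rho_1G_i+\rho_2 1_{\{\Delta_i<-G_{\max}-\alpha_dS_i\}}\Big].$$ If $f_\Delta$ is increasing on $(-\infty,0]$, then there exist $S_{c,i}$ and $S_{d,i}$ with $0\le S_{c,i}\le S_{d,i}\le S_{\max}$, $i=1,2$, such that the policy which at time $i$ uses the two-threshold policy with parameters $(S_{c,i},S_{d,i})$, $i=1,2$, is optimal.
   Context: Constants: charging efficiency $\alpha_c\in(0,1)$, discharging efficiency $\alpha_d\in(0,1)$, fast-ramping generation capacity $G_{\max}\ge0$, power storage capacity $S_{\max}\ge0$. The initial stored power $S_1\in[0,S_{\max}]$ is given; $\Delta_1,\Delta_2$ are exogenous. An admissible policy chooses $(G_i,C_i,D_i)$ (fast-ramping generation, charging, discharging) as a measurable function of the past, $S_i$ and $\Delta_i$, such that for $i=1,2$: $S_{i+1}=S_i+\alpha_cC_i-\frac1{\alpha_d}D_i$, $0\le S_i\le S_{\max}$, $0\le S_{i+1}\le S_{\max}$, $C_i\ge0$, $D_i\ge0$, $0\le G_i\le G_{\max}$, and $0\le G_i-C_i+D_i+\max\{\Delta_i,-G_{\max}-\alpha_dS_i\}$. Two-threshold policy with parameters $(S_c,S_d)$, $0\le S_c\le S_d\le S_{\max}$ (charging and discharging thresholds); each line gives $(G_i,C_i,D_i)$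 as a function of $(S_i,\Delta_i)$. (a) $0\le S_i<S_c$: - $\frac{S_{\max}-S_i}{\alpha_c}\le\Delta_i$: $(0,\frac{S_{\max}-S_i}{\alpha_c},0)$; - $\frac{S_c-S_i}{\alpha_c}\le\Delta_i<\frac{S_{\max}-S_i}{\alpha_c}$: $(0,\Delta_i,0)$; - $\frac{S_c-S_i}{\alpha_c}-G_{\max}\le\Delta_i<\frac{S_c-S_i}{\alpha_c}$: $(\frac{S_c-S_i}{\alpha_c}-\Delta_i,\frac{S_c-S_i}{\alpha_c},0)$; - $-G_{\max}\le\Delta_i<\frac{S_c-S_i}{\alpha_c}-G_{\max}$: $(G_{\max},G_{\max}+\Delta_i,0)$; - $-G_{\max}-\alpha_dS_i\le\Delta_i<-G_{\max}$: $(G_{\max},0,-G_{\max}-\Delta_i)$; - $\Delta_i<-G_{\max}-\alpha_dS_i$: $(G_{\max},0,\alpha_dS_i)$. (b) $S_c\le S_i\le S_d$: - $\frac{S_{\max}-S_i}{\alpha_c}\le\Delta_i$: $(0,\frac{S_{\max}-S_i}{\alpha_c},0)$; - $0\le\Delta_i<\frac{S_{\max}-S_i}{\alpha_c}$: $(0,\Delta_i,0)$; - $-G_{\max}\le\Delta_i<0$: $(-\Delta_i,0,0)$; - $-G_{\max}-\alpha_dS_i\le\Delta_i<-G_{\max}$: $(G_{\max},0,-G_{\max}-\Delta_i)$; - $\Delta_i<-G_{\max}-\alpha_dS_i$: $(G_{\max},0,\alpha_dS_i)$. (c) $S_d<S_i\le S_{\max}$: - $\frac{S_{\max}-S_i}{\alpha_c}\le\Delta_i$: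 $(0,\frac{S_{\max}-S_i}{\alpha_c},0)$; - $0\le\Delta_i<\frac{S_{\max}-S_i}{\alpha_c}$: $(0,\Delta_i,0)$; - $-\alpha_d(S_i-S_d)\le\Delta_i<0$: $(0,0,-\Delta_i)$; - $-\alpha_d(S_i-S_d)-G_{\max}\le\Delta_i<-\alpha_d(S_i-S_d)$: $(-\Delta_i-\alpha_d(S_i-S_d),0,\alpha_d(S_i-S_d))$; - $-G_{\max}-\alpha_dS_i\le\Delta_i<-\alpha_d(S_i-S_d)-G_{\max}$: $(G_{\max},0,-G_{\max}-\Delta_i)$; - $\Delta_i<-G_{\max}-\alpha_dS_i$: $(G_{\max},0,\alpha_dS_i)$. *)

theory Defs
  imports "HOL-Probability.Probability"
begin

text \<open>An action is a triple \<open>(G, C, D)\<close>: fast-ramping generation, charging, discharging.\<close>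

type_synonym action = "real \<times> real \<times> real"

text \<open>
  A two-slot policy. The first rule maps \<open>(S\<^sub>1, \<Delta>\<^sub>1)\<close> to an action. The second maps
  \<open>((S\<^sub>1, \<Delta>\<^sub>1, (G\<^sub>1, C\<^sub>1, D\<^sub>1)), S\<^sub>2, \<Delta>\<^sub>2)\<close> to an action, its first component being the past.
\<close>

type_synonym policy =
  "(real \<times> real \<Rightarrow> action) \<times> ((real \<times> real \<times> action) \<times> real \<times> real \<Rightarrow> action)"

definition next_state :: "real \<Rightarrow> real \<Rightarrow> real \<Rightarrow> action \<Rightarrow> real" where
  "next_state \<alpha>c \<alpha>d S a = (case a of (G, C, D) \<Rightarrow> S + \<alpha>c * C - (1 / \<alpha>d) * D)"

definition feasible ::
  "real \<Rightarrow> real \<Rightarrow> real \<Rightarrow> real \<Rightarrow> real \<Rightarrow> real \<Rightarrow> action \<Rightarrow> bool" where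
  "feasible \<alpha>c \<alpha>d Gmax Smax S \<delta> a = (case a of (G, C, D) \<Rightarrow>
     0 \<le> S \<and> S \<le> Smax \<and>
     0 \<le> next_state \<alpha>c \<alpha>d S a \<and> next_state \<alpha>c \<alpha>d S a \<le> Smax \<and>
     C \<ge> 0 \<and> D \<ge> 0 \<and> 0 \<le> G \<and> G \<le> Gmax \<and>
     0 \<le> G - C + D + max \<delta> (- Gmax - \<alpha>d * S))"

definition action1 :: "policy \<Rightarrow> real \<Rightarrow> real \<Rightarrow> action" where
  "action1 \<pi> S1 \<delta>1 = fst \<pi> (S1, \<delta>1)"

definition state2 :: "real \<Rightarrow> real \<Rightarrow> policy \<Rightarrow> real \<Rightarrow> real \<Rightarrow> real" where
  "state2 \<alpha>c \<alpha>d \<pi> S1 \<delta>1 = next_state \<alpha>c \<alpha>d S1 (action1 \<pi> S1 \<delta>1)"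

definition action2 :: "real \<Rightarrow> real \<Rightarrow> policy \<Rightarrow> real \<Rightarrow> real \<Rightarrow> real \<Rightarrow> action" where
  "action2 \<alpha>c \<alpha>d \<pi> S1 \<delta>1 \<delta>2 =
     snd \<pi> ((S1, \<delta>1, action1 \<pi> S1 \<delta>1), state2 \<alpha>c \<alpha>d \<pi> S1 \<delta>1, \<delta>2)"

text \<open>The constraints are imposed at every outcome of the sample space.\<close>

definition admissible ::
  "real \<Rightarrow> real \<Rightarrow> real \<Rightarrow> real \<Rightarrow> real \<Rightarrow> 'a measure \<Rightarrow> (nat \<Rightarrow> 'a \<Rightarrow> real) \<Rightarrow> policy \<Rightarrow> bool" where
  "admissible \<alpha>c \<alpha>d Gmax Smax S1 M \<Delta> \<pi> \<longleftrightarrow>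
     fst \<pi> \<in> borel_measurable borel \<and> snd \<pi> \<in> borel_measurable borel \<and>
     (\<forall>\<omega>\<in>space M.
        feasible \<alpha>c \<alpha>d Gmax Smax S1 (\<Delta> 1 \<omega>) (action1 \<pi> S1 (\<Delta> 1 \<omega>)) \<and>
        feasible \<alpha>c \<alpha>d Gmax Smax (state2 \<alpha>c \<alpha>d \<pi> S1 (\<Delta> 1 \<omega>)) (\<Delta> 2 \<omega>)
          (action2 \<alpha>c \<alpha>d \<pi> S1 (\<Delta> 1 \<omega>) (\<Delta> 2 \<omega>)))"

definition stage_cost ::
  "real \<Rightarrow> real \<Rightarrow> real \<Rightarrow> real \<Rightarrow> real \<Rightarrow> real \<Rightarrow> action \<Rightarrow> real" where
  "stage_cost \<alpha>d Gmax \<rho>1 \<rho>2 S \<delta> a = (case a of (G, C, D) \<Rightarrow>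
     \<rho>1 * G + \<rho>2 * (if \<delta> < - Gmax - \<alpha>d * S then 1 else 0))"

text \<open>
  For an admissible policy the integrand is measurable and bounded, so the Bochner integral
  is the true expectation.
\<close>

definition expected_cost ::
  "real \<Rightarrow> real \<Rightarrow> real \<Rightarrow> real \<Rightarrow> real \<Rightarrow> real \<Rightarrow> 'a measure \<Rightarrow> (nat \<Rightarrow> 'a \<Rightarrow> real) \<Rightarrow> policy \<Rightarrow> real"
  where
  "expected_cost \<alpha>c \<alpha>d Gmax \<rho>1 \<rho>2 S1 M \<Delta> \<pi> = (LINT \<omega>|M.
     stage_cost \<alpha>d Gmax \<rho>1 \<rho>2 S1 (\<Delta> 1 \<omega>) (action1 \<pi> S1 (\<Delta> 1 \<omega>)) +
     stage_cost \<alpha>d Gmax \<rho>1 \<rho>2 (state2 \<alpha>c \<alpha>d \<pi> S1 (\<Delta> 1 \<omega>)) (\<Delta> 2 \<omega>)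
       (action2 \<alpha>c \<alpha>d \<pi> S1 (\<Delta> 1 \<omega>) (\<Delta> 2 \<omega>)))"

definition optimal ::
  "real \<Rightarrow> real \<Rightarrow> real \<Rightarrow> real \<Rightarrow> real \<Rightarrow> real \<Rightarrow> real \<Rightarrow> 'a measure \<Rightarrow> (nat \<Rightarrow> 'a \<Rightarrow> real)
     \<Rightarrow> policy \<Rightarrow> bool" where
  "optimal \<alpha>c \<alpha>d Gmax Smax \<rho>1 \<rho>2 S1 M \<Delta> \<pi> \<longleftrightarrow>
     admissible \<alpha>c \<alpha>d Gmax Smax S1 M \<Delta> \<pi> \<and>
     (\<forall>\<pi>'. admissible \<alpha>c \<alpha>d Gmax Smax S1 M \<Delta> \<pi>' \<longrightarrow>
        expected_cost \<alpha>c \<alpha>d Gmax \<rho>1 \<rho>2 S1 M \<Delta> \<pi> \<le> expected_cost \<alpha>c \<alpha>d Gmax \<rho>1 \<rho>2 S1 M \<Delta> \<pi>')"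

text \<open>
  In each branch the cases are listed by decreasing \<open>\<delta>\<close>, so that the lower bound tested in one
  line is the strict upper bound of the next; this needs \<open>0 \<le> Sc \<le> Sd \<le> Smax\<close> and
  \<open>0 \<le> S \<le> Smax\<close>. Values for \<open>S\<close> outside that interval are irrelevant.
\<close>

definition two_threshold ::
  "real \<Rightarrow> real \<Rightarrow> real \<Rightarrow> real \<Rightarrow> real \<Rightarrow> real \<Rightarrow> real \<Rightarrow> real \<Rightarrow> action" where
  "two_threshold \<alpha>c \<alpha>d Gmax Smax Sc Sd S \<delta> =
    (if S < Sc then
       (if (Smax - S) / \<alpha>c \<le> \<delta> then (0, (Smax - S) / \<alpha>c, 0)
        else if (Sc - S) / \<alpha>c \<le> \<delta> then (0, \<delta>, 0)
        else if (Sc - S) / \<alpha>c - Gmax \<le> \<delta> then ((Sc - S) / \<alpha>c - \<delta>, (Sc - S) / \<alpha>c, 0)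
        else if - Gmax \<le> \<delta> then (Gmax, Gmax + \<delta>, 0)
        else if - Gmax - \<alpha>d * S \<le> \<delta> then (Gmax, 0, - Gmax - \<delta>)
        else (Gmax, 0, \<alpha>d * S))
     else if S \<le> Sd then
       (if (Smax - S) / \<alpha>c \<le> \<delta> then (0, (Smax - S) / \<alpha>c, 0)
        else if 0 \<le> \<delta> then (0, \<delta>, 0)
        else if - Gmax \<le> \<delta> then (- \<delta>, 0, 0)
        else if - Gmax - \<alpha>d * S \<le> \<delta> then (Gmax, 0, - Gmax - \<delta>)
        else (Gmax, 0, \<alpha>d * S))
     else
       (if (Smax - S) / \<alpha>c \<le> \<delta> then (0, (Smax - S) / \<alpha>c, 0)
        else if 0 \<le> \<delta> then (0, \<delta>, 0)
        else if - \<alpha>d * (S - Sd) \<le> \<delta> then (0, 0, - \<delta>)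
        else if - \<alpha>d * (S - Sd) - Gmax \<le> \<delta> then (- \<delta> - \<alpha>d * (S - Sd), 0, \<alpha>d * (S - Sd))
        else if - Gmax - \<alpha>d * S \<le> \<delta> then (Gmax, 0, - Gmax - \<delta>)
        else (Gmax, 0, \<alpha>d * S)))"

definition two_threshold_policy ::
  "real \<Rightarrow> real \<Rightarrow> real \<Rightarrow> real \<Rightarrow> (nat \<Rightarrow> real) \<Rightarrow> (nat \<Rightarrow> real) \<Rightarrow> policy" where
  "two_threshold_policy \<alpha>c \<alpha>d Gmax Smax Sc Sd =
     ((\<lambda>(S, \<delta>). two_threshold \<alpha>c \<alpha>d Gmax Smax (Sc 1) (Sd 1) S \<delta>),
      (\<lambda>(past, S, \<delta>). two_threshold \<alpha>c \<alpha>d Gmax Smax (Sc 2) (Sd 2) S \<delta>))"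

end

theory Submission
  imports Defs
begin

text \<open>
  In the second slot discharging as much as possible is best, and costs \<open>\<phi> (- \<Delta>\<^sub>2 - \<alpha>d S\<^sub>2)\<close> with \<open>\<phi>\<close>
  nondecreasing and zero on the negative axis. Hence the value function is
  \<open>V S = E (\<phi> (- \<Delta>\<^sub>2 - \<alpha>d S))\<close>, and the substitution \<open>y = - x - s\<close> in the integral turns its decrease
  over a step \<open>h\<close> into \<open>\<integral> f (- y - s) (\<phi> y - \<phi> (y - h)) dy\<close> (with \<open>s\<close>, \<open>h\<close> scaled by \<open>\<alpha>d\<close>), which is
  nonincreasing in \<open>s\<close> because \<open>f\<close> increases on the negative axis: \<open>V\<close> is convex.

  In the first slot, moving the stored power from \<open>S\<close> to \<open>x\<close> takes at least \<open>(x - S) / \<alpha>c\<close> units of power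
  if \<open>x \<ge> S\<close>, and yields at most \<open>\<alpha>d (S - x)\<close> if \<open>x \<le> S\<close>. The thresholds are the minimisers of
  \<open>\<rho>1 x / \<alpha>c + V x\<close> and \<open>\<rho>1 \<alpha>d x + V x\<close>, and convexity makes it optimal to move as far towards
  them as possible.
\<close>

section \<open>Minimal cost of the last slot\<close>

text \<open>The argument \<open>y\<close> stands for \<open>- \<delta> - \<alpha>d * S\<close>, the
  shortage left once the storage is emptied. The event \<open>Gmax < y\<close> is then the penalty
  event of \<open>stage_cost\<close>.\<close>

definition shortfall_cost :: "real \<Rightarrow> real \<Rightarrow> real \<Rightarrow> real \<Rightarrow> real" where
  "shortfall_cost Gmax \<rho>1 \<rho>2 y = \<rho>1 * min Gmax (max 0 y) + \<rho>2 * (if Gmax < y then 1 else 0)"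

lemma shortfall_cost_measurable [measurable]: "shortfall_cost Gmax \<rho>1 \<rho>2 \<in> borel_measurable borel"
  unfolding shortfall_cost_def by measurable

context
  fixes Gmax \<rho>1 \<rho>2 :: real
  assumes Gmax: "0 \<le> Gmax" and rho1: "0 \<le> \<rho>1" and rho2: "0 \<le> \<rho>2"
begin

lemma shortfall_cost_nonneg: "0 \<le> shortfall_cost Gmax \<rho>1 \<rho>2 y"
  unfolding shortfall_cost_def using Gmax rho1 rho2 by simp

lemma shortfall_cost_le: "shortfall_cost Gmax \<rho>1 \<rho>2 y \<le> \<rho>1 * Gmax + \<rho>2"
  unfolding shortfall_cost_def using Gmax rho1 rho2
  by (intro add_mono mult_left_mono) auto

lemma shortfall_cost_mono: "mono (shortfall_cost Gmax \<rho>1 \<rho>2)"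
  unfolding shortfall_cost_def using Gmax rho1 rho2
  by (intro monoI add_mono mult_left_mono) auto

lemma shortfall_cost_eq_0: "y \<le> 0 \<Longrightarrow> shortfall_cost Gmax \<rho>1 \<rho>2 y = 0"
  unfolding shortfall_cost_def using Gmax by simp

text \<open>The penalty is the indicator of an open half-line, so its jump at \<open>Gmax\<close> is
  invisible from the left. Storage decreasing to 0 makes the shortage increase, so this side gives
  right-continuity of the value function at 0.\<close>

lemma shortfall_cost_left_continuous:
  assumes "X \<longlonglongrightarrow> y" "\<And>n. X n \<le> y"
  shows "(\<lambda>n. shortfall_cost Gmax \<rho>1 \<rho>2 (X n)) \<longlonglongrightarrow> shortfall_cost Gmax \<rho>1 \<rho>2 y"
proof -
  have "(\<lambda>n. if Gmax < X n then 1 else 0) \<longlonglongrightarrow> (if Gmax < y then 1 else (0::real))"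
  proof (cases "Gmax < y")
    case True
    then have "\<forall>\<^sub>F n in sequentially. Gmax < X n"
      using assms(1) by (simp add: order_tendstoD(1))
    then show ?thesis
      using True by (intro tendsto_eventually) (auto elim: eventually_mono)
  next
    case False
    then have "\<not> Gmax < X n" for n
      using assms(2)[of n] by linarith
    then show ?thesis
      using False by simp
  qed
  then show ?thesis
    unfolding shortfall_cost_def
    by (intro tendsto_add tendsto_mult tendsto_const tendsto_min tendsto_max assms(1))
qed

end

section \<open>Monotone increments from a density increasing on the negative axis\<close>

lemma increment_integral_antimono:
  fixes f \<phi> :: "real \<Rightarrow> real"
  assumes f_int: "integrable lborel f" and f_nonneg: "\<And>x. 0 \<le> f x" and f_mono: "mono_on {..0} f"
    and [measurable]: "\<phi> \<in> borel_measurable borel"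
    and phi: "mono \<phi>" "\<And>y. y \<le> 0 \<Longrightarrow> \<phi> y = 0" "\<And>y. \<bar>\<phi> y\<bar> \<le> B"
    and st: "0 \<le> s" "s \<le> t" and h: "0 \<le> h"
  shows "(LINT x|lborel. f x * \<phi> (- x - t)) - (LINT x|lborel. f x * \<phi> (- x - (t + h)))
       \<le> (LINT x|lborel. f x * \<phi> (- x - s)) - (LINT x|lborel. f x * \<phi> (- x - (s + h)))"
proof -
  have [measurable]: "f \<in> borel_measurable borel"
    using borel_measurable_integrable[OF f_int] by simp
  have B: "0 \<le> B"
    using phi(3)[of 0] by linarith
  have int: "integrable lborel (\<lambda>x. f x * \<phi> (- x - u))" for u
  proof (rule Bochner_Integration.integrable_bound)
    show "integrable lborel (\<lambda>x. B * f x)"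
      using f_int by simp
    show "AE x in lborel. norm (f x * \<phi> (- x - u)) \<le> norm (B * f x)"
      using phi(3) B f_nonneg
      by (auto simp: abs_mult mult.commute[of B] intro!: mult_left_mono)
  qed simp
  \<comment> \<open>The substitution \<open>x = - y - u\<close> moves the shift \<open>u\<close>
    from \<phi> into the density, so that \<open>g t\<close> and \<open>g s\<close> can be compared
    pointwise.\<close>
  define g where "g u y = f (- y - u) * (\<phi> y - \<phi> (y - h))" for u y
  have int': "integrable lborel (\<lambda>x. f x * \<phi> (- x - u) - f x * \<phi> (- x - (u + h)))" for u
    using int by simp
  have g: "integrable lborel (g u)"
    "(LINT x|lborel. f x * \<phi> (- x - u)) - (LINT x|lborel. f x * \<phi> (- x - (u + h))) = integral\<^sup>L lborel (g u)" for u
  proof -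
    have eq: "(\<lambda>x. f (- u + - 1 * x) * \<phi> (- (- u + - 1 * x) - u) -
        f (- u + - 1 * x) * \<phi> (- (- u + - 1 * x) - (u + h))) = g u"
      unfolding g_def by (auto simp: algebra_simps)
    show "integrable lborel (g u)"
      using lborel_integrable_real_affine[OF int'[of u], of "-1" "-u"] unfolding eq by simp
    have "(LINT x|lborel. f x * \<phi> (- x - u)) - (LINT x|lborel. f x * \<phi> (- x - (u + h)))
      = (LINT x|lborel. f x * \<phi> (- x - u) - f x * \<phi> (- x - (u + h)))"
      using int by simp
    also have "\<dots> = integral\<^sup>L lborel (g u)"
      by (subst lborel_integral_real_affine[of "-1" _ "-u"]) (simp_all only: eq, simp_all)
    finally show "(LINT x|lborel. f x * \<phi> (- x - u)) - (LINT x|lborel. f x * \<phi> (- x - (u + h)))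
      = integral\<^sup>L lborel (g u)" .
  qed
  \<comment> \<open>For \<open>y \<le> 0\<close> both \<open>\<phi> y\<close> and
    \<open>\<phi> (y - h)\<close> vanish. For \<open>y > 0\<close> both arguments of
    \<open>f\<close> are negative, where \<open>f\<close> increases.\<close>
  have "g t y \<le> g s y" for y
  proof (cases "y \<le> 0")
    case True
    then show ?thesis using phi(2) h by (simp add: g_def)
  next
    case False
    have "f (- y - t) \<le> f (- y - s)"
      using False st by (intro mono_onD[OF f_mono]) auto
    moreover have "\<phi> (y - h) \<le> \<phi> y"
      using phi(1) h by (simp add: monoD)
    ultimately show ?thesis
      unfolding g_def by (intro mult_right_mono) auto
  qed
  then have "integral\<^sup>L lborel (g t) \<le> integral\<^sup>L lborel (g s)"
    using g(1) by (intro integral_mono) auto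
  then show ?thesis
    unfolding g(2) .
qed

section \<open>Convex value functions and their thresholds\<close>

text \<open>
  Convexity is used only in the form of monotone increments, which also transfers right-continuity
  at \<open>0\<close> to the whole interval.
\<close>

locale convex_value =
  fixes V :: "real \<Rightarrow> real" and X :: real
  assumes antimono: "\<And>s t. 0 \<le> s \<Longrightarrow> s \<le> t \<Longrightarrow> V t \<le> V s"
    and increments: "\<And>s t h. 0 \<le> s \<Longrightarrow> s \<le> t \<Longrightarrow> 0 \<le> h \<Longrightarrow> V t - V (t + h) \<le> V s - V (s + h)"
    and right_continuous: "(\<lambda>n. V (1 / Suc n)) \<longlonglongrightarrow> V 0"
    and X_nonneg: "0 \<le> X"
begin

lemma continuous: "continuous_on {0..X} V"
proof (rule uniformly_continuous_imp_continuous)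
  show "uniformly_continuous_on {0..X} V"
    unfolding uniformly_continuous_on_def
  proof (intro allI impI)
    fix e :: real assume "0 < e"
    have "\<forall>\<^sub>F n in sequentially. dist (V (1 / Suc n)) (V 0) < e"
      using right_continuous \<open>0 < e\<close> by (rule tendstoD)
    then obtain n where n: "dist (V (1 / Suc n)) (V 0) < e"
      by (auto simp: eventually_sequentially)
    have close: "\<bar>V y - V x\<bar> < e" if "0 \<le> x" "x \<le> y" "y - x < 1 / Suc n" for x y
    proof -
      \<comment> \<open>Among all steps of length \<open>y - x\<close>, the one starting at 0 has
        the largest drop. This gives a modulus of continuity independent of the point.\<close>
      have "V x - V y \<le> V 0 - V (y - x)"
        using increments[of 0 x "y - x"] that by simp
      also have "\<dots> \<le> V 0 - V (1 / Suc n)"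
        using antimono[of "y - x" "1 / Suc n"] that by simp
      also have "\<dots> < e"
        using n by (simp add: dist_real_def)
      finally show ?thesis
        using antimono[OF that(1,2)] by simp
    qed
    have "dist (V y) (V x) < e" if "0 \<le> x" "0 \<le> y" "dist y x < 1 / Suc n" for x y
      using close[of x y] close[of y x] that by (cases "x \<le> y") (auto simp: dist_real_def)
    then show "\<exists>d>0. \<forall>x\<in>{0..X}. \<forall>x'\<in>{0..X}. dist x' x < d \<longrightarrow> dist (V x') (V x) < e"
      by (intro exI[of _ "1 / Suc n"]) auto
  qed
qed

text \<open>The parameter \<open>a\<close> is a unit price of stored power. Minimisers may form an
  interval; any one of them will do.\<close>

definition threshold :: "real \<Rightarrow> real" where
  "threshold a = (SOME m. m \<in> {0..X} \<and> (\<forall>x\<in>{0..X}. a * m + V m \<le> a * x + V x))"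

lemma threshold:
  shows threshold_nonneg: "0 \<le> threshold a" and threshold_le: "threshold a \<le> X"
    and threshold_min: "0 \<le> x \<Longrightarrow> x \<le> X \<Longrightarrow> a * threshold a + V (threshold a) \<le> a * x + V x"
proof -
  have "\<exists>m\<in>{0..X}. \<forall>x\<in>{0..X}. a * m + V m \<le> a * x + V x"
    using X_nonneg by (intro continuous_attains_inf continuous_intros continuous) auto
  then have "threshold a \<in> {0..X} \<and> (\<forall>x\<in>{0..X}. a * threshold a + V (threshold a) \<le> a * x + V x)"
    unfolding threshold_def Bex_def by (rule someI_ex)
  then show "0 \<le> threshold a" "threshold a \<le> X"
    "0 \<le> x \<Longrightarrow> x \<le> X \<Longrightarrow> a * threshold a + V (threshold a) \<le> a * x + V x"
    by auto
qed

text \<open>Slide the segment from \<open>x\<close> to \<open>y\<close> left until it starts at the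
  minimiser. There the objective does not decrease along it, and by convexity its increment over the
  original segment is at least as large.\<close>

lemma threshold_right:
  assumes "threshold a \<le> x" "x \<le> y" "y \<le> X"
  shows "a * x + V x \<le> a * y + V y"
  using increments[of "threshold a" x "y - x"] threshold_min[of "threshold a + (y - x)" a]
    threshold_nonneg[of a] assms
  by (simp add: algebra_simps)

text \<open>The mirror image: the segment slides right until it ends at the minimiser.\<close>

lemma threshold_left:
  assumes "0 \<le> x" "x \<le> y" "y \<le> threshold a"
  shows "a * y + V y \<le> a * x + V x"
  using increments[of x "threshold a - (y - x)" "y - x"] threshold_min[of "threshold a - (y - x)" a]
    threshold_le[of a] assms
  by (simp add: algebra_simps)

text \<open>Adding the two minimality inequalities, each tested at the other minimiser, cancels
  \<open>V\<close>.\<close>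

lemma threshold_antimono:
  assumes "b \<le> a" shows "threshold a \<le> threshold b"
proof (cases "a = b")
  case False
  have "(a - b) * (threshold a - threshold b) \<le> 0"
    using threshold_min[of "threshold b" a] threshold_min[of "threshold a" b]
      threshold_nonneg threshold_le by (simp add: algebra_simps add_mono)
  then show ?thesis
    using False assms by (simp add: mult_le_0_iff)
qed simp

end

section \<open>Feasible actions and the two-threshold rule\<close>

locale storage =
  fixes \<alpha>c \<alpha>d Gmax Smax :: real
  assumes \<alpha>c: "0 < \<alpha>c" "\<alpha>c < 1" and \<alpha>d: "0 < \<alpha>d" "\<alpha>d < 1"
    and Gmax: "0 \<le> Gmax"
begin

text \<open>Charging and discharging at once only wastes power, as \<alpha>c \<alpha>d < 1. Both
  lower bounds on \<open>G\<close> hold whatever the sign of \<open>x - S\<close>; the first is the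
  stronger for \<open>x \<le> S\<close>, the second for \<open>x \<ge> S\<close>.\<close>

lemma feasible_bounds:
  assumes "feasible \<alpha>c \<alpha>d Gmax Smax S \<delta> (G, C, D)"
  defines "x \<equiv> next_state \<alpha>c \<alpha>d S (G, C, D)"
  shows "0 \<le> x" "x \<le> Smax" "0 \<le> G" "G \<le> Gmax"
    and "\<alpha>d * (x - S) \<le> G + max \<delta> (- Gmax - \<alpha>d * S)"
    and "(x - S) / \<alpha>c \<le> G + max \<delta> (- Gmax - \<alpha>d * S)"
proof -
  have a: "0 \<le> C" "0 \<le> D" "C - D \<le> G + max \<delta> (- Gmax - \<alpha>d * S)"
    using assms(1) by (auto simp: feasible_def)
  have x: "x - S = \<alpha>c * C - D / \<alpha>d"
    by (simp add: x_def next_state_def)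
  have le1: "\<alpha>d * \<alpha>c \<le> 1"
    using \<alpha>c \<alpha>d by (simp add: mult_le_one)
  have "\<alpha>d * (x - S) = (\<alpha>d * \<alpha>c) * C - D"
    using \<alpha>d by (simp add: x right_diff_distrib mult.assoc)
  also have "\<dots> \<le> C - D"
    using le1 a(1) by (simp add: mult_left_le_one_le \<alpha>c \<alpha>d less_imp_le)
  finally show "\<alpha>d * (x - S) \<le> G + max \<delta> (- Gmax - \<alpha>d * S)"
    using a(3) by simp
  have "(x - S) / \<alpha>c = C - D / (\<alpha>d * \<alpha>c)"
    using \<alpha>c by (simp add: x diff_divide_distrib)
  also have "\<dots> \<le> C - D"
    using le1 a(2) \<alpha>c \<alpha>d by (simp add: pos_le_divide_eq mult_left_le)
  finally show "(x - S) / \<alpha>c \<le> G + max \<delta> (- Gmax - \<alpha>d * S)"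
    using a(3) by simp
qed (use assms in \<open>auto simp: feasible_def\<close>)

text \<open>The seventeen branches grouped by action. The threshold bounds in \<open>surplus\<close>
  and \<open>discharge_max\<close> also hold in branches that do not test them, by the position of
  \<open>S\<close> relative to \<open>Sc\<close> and \<open>Sd\<close>.\<close>

lemma two_threshold_cases:
  fixes Sc Sd S \<delta> :: real
  defines "t \<equiv> two_threshold \<alpha>c \<alpha>d Gmax Smax Sc Sd S \<delta>"
  assumes "Sc \<le> Sd" "Sd \<le> Smax" "0 \<le> S" "S \<le> Smax"
  obtains
    (full) "t = (0, (Smax - S) / \<alpha>c, 0)" "(Smax - S) / \<alpha>c \<le> \<delta>"
  | (surplus) "t = (0, \<delta>, 0)" "0 \<le> \<delta>" "(Sc - S) / \<alpha>c \<le> \<delta>" "\<delta> < (Smax - S) / \<alpha>c"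
  | (charge) "t = ((Sc - S) / \<alpha>c - \<delta>, (Sc - S) / \<alpha>c, 0)" "S < Sc"
      "(Sc - S) / \<alpha>c - Gmax \<le> \<delta>" "\<delta> < (Sc - S) / \<alpha>c"
  | (charge_max) "t = (Gmax, Gmax + \<delta>, 0)" "- Gmax \<le> \<delta>" "\<delta> < (Sc - S) / \<alpha>c - Gmax"
  | (hold) "t = (- \<delta>, 0, 0)" "Sc \<le> S" "S \<le> Sd" "- Gmax \<le> \<delta>" "\<delta> < 0"
  | (cover) "t = (0, 0, - \<delta>)" "- \<alpha>d * (S - Sd) \<le> \<delta>" "\<delta> < 0"
  | (discharge) "t = (- \<delta> - \<alpha>d * (S - Sd), 0, \<alpha>d * (S - Sd))" "Sd < S"
      "- \<alpha>d * (S - Sd) - Gmax \<le> \<delta>" "\<delta> < - \<alpha>d * (S - Sd)"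
  | (discharge_max) "t = (Gmax, 0, - Gmax - \<delta>)" "- Gmax - \<alpha>d * S \<le> \<delta>" "\<delta> < - Gmax"
      "\<delta> \<le> - \<alpha>d * (S - Sd) - Gmax"
  | (empty) "t = (Gmax, 0, \<alpha>d * S)" "\<delta> < - Gmax - \<alpha>d * S"
proof -
  have c: "S < Sc \<Longrightarrow> 0 < (Sc - S) / \<alpha>c" "Sc \<le> S \<Longrightarrow> (Sc - S) / \<alpha>c \<le> 0"
    using \<alpha>c by (simp_all add: divide_nonpos_pos)
  have d: "S \<le> Sd \<Longrightarrow> 0 \<le> - \<alpha>d * (S - Sd)" "Sd < S \<Longrightarrow> - \<alpha>d * (S - Sd) < 0" "0 \<le> \<alpha>d * S"
    using \<alpha>d assms by (simp_all add: mult_nonneg_nonpos)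
  consider "S < Sc" | "\<not> S < Sc" "S \<le> Sd" | "\<not> S < Sc" "\<not> S \<le> Sd"
    using assms(2) by linarith
  then show thesis
  proof cases
    case 1
    then have "t = (if (Smax - S) / \<alpha>c \<le> \<delta> then (0, (Smax - S) / \<alpha>c, 0)
        else if (Sc - S) / \<alpha>c \<le> \<delta> then (0, \<delta>, 0)
        else if (Sc - S) / \<alpha>c - Gmax \<le> \<delta> then ((Sc - S) / \<alpha>c - \<delta>, (Sc - S) / \<alpha>c, 0)
        else if - Gmax \<le> \<delta> then (Gmax, Gmax + \<delta>, 0)
        else if - Gmax - \<alpha>d * S \<le> \<delta> then (Gmax, 0, - Gmax - \<delta>)
        else (Gmax, 0, \<alpha>d * S))"
      by (simp only: t_def two_threshold_def if_True)
    then show ?thesis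
      using 1 assms(2,3) c(1) d(1) that by (smt (verit))
  next
    case 2
    then have "t = (if (Smax - S) / \<alpha>c \<le> \<delta> then (0, (Smax - S) / \<alpha>c, 0)
        else if 0 \<le> \<delta> then (0, \<delta>, 0)
        else if - Gmax \<le> \<delta> then (- \<delta>, 0, 0)
        else if - Gmax - \<alpha>d * S \<le> \<delta> then (Gmax, 0, - Gmax - \<delta>)
        else (Gmax, 0, \<alpha>d * S))"
      by (simp only: t_def two_threshold_def if_True if_False)
    then show ?thesis
      using 2 c(2) d(1) that by (smt (verit))
  next
    case 3
    then have "t = (if (Smax - S) / \<alpha>c \<le> \<delta> then (0, (Smax - S) / \<alpha>c, 0)
        else if 0 \<le> \<delta> then (0, \<delta>, 0)
        else if - \<alpha>d * (S - Sd) \<le> \<delta> then (0, 0, - \<delta>)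
        else if - \<alpha>d * (S - Sd) - Gmax \<le> \<delta> then (- \<delta> - \<alpha>d * (S - Sd), 0, \<alpha>d * (S - Sd))
        else if - Gmax - \<alpha>d * S \<le> \<delta> then (Gmax, 0, - Gmax - \<delta>)
        else (Gmax, 0, \<alpha>d * S))"
      by (simp only: t_def two_threshold_def if_False)
    then show ?thesis
      using 3 assms(2) c(2) d(2) that by (smt (verit))
  qed
qed

lemma two_threshold_feasible:
  assumes "0 \<le> Sc" "Sc \<le> Sd" "Sd \<le> Smax" "0 \<le> S" "S \<le> Smax"
  shows "feasible \<alpha>c \<alpha>d Gmax Smax S \<delta> (two_threshold \<alpha>c \<alpha>d Gmax Smax Sc Sd S \<delta>)"
proof -
  have d: "0 \<le> \<alpha>d * S" "\<alpha>d * (S - Sd) \<le> \<alpha>d * S"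
    using \<alpha>d assms by (auto intro: mult_left_mono)
  show ?thesis
    using assms(2-5)
  proof (cases rule: two_threshold_cases[where \<delta> = \<delta>])
    case full
    then show ?thesis
      using \<alpha>c Gmax assms d by (auto simp: feasible_def next_state_def)
  next
    case surplus
    then show ?thesis
      using \<alpha>c Gmax assms d by (auto simp: feasible_def next_state_def field_simps)
  next
    case charge
    then show ?thesis
      using \<alpha>c Gmax assms d by (auto simp: feasible_def next_state_def)
  next
    case charge_max
    have "\<alpha>c * (Gmax + \<delta>) < Sc - S"
      using charge_max(3) \<alpha>c by (simp add: field_simps)
    moreover have "0 \<le> \<alpha>c * (Gmax + \<delta>)"
      using charge_max(2) \<alpha>c by simp
    ultimately show ?thesis
      using charge_max Gmax assms d by (auto simp: feasible_def next_state_def)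
  next
    case hold
    then show ?thesis
      using Gmax assms d by (auto simp: feasible_def next_state_def)
  next
    case cover
    have "Sd - S \<le> \<delta> / \<alpha>d" "\<delta> / \<alpha>d \<le> 0"
      using cover(2,3) \<alpha>d by (simp_all add: field_simps)
    then show ?thesis
      using cover Gmax assms d by (auto simp: feasible_def next_state_def)
  next
    case discharge
    then show ?thesis
      using \<alpha>d Gmax assms d by (auto simp: feasible_def next_state_def)
  next
    case discharge_max
    have "- S \<le> (Gmax + \<delta>) / \<alpha>d" "(Gmax + \<delta>) / \<alpha>d \<le> 0"
      using discharge_max(2,3) \<alpha>d by (simp_all add: field_simps)
    moreover have "(- Gmax - \<delta>) / \<alpha>d = - ((Gmax + \<delta>) / \<alpha>d)"
      by (simp add: minus_divide_left)
    ultimately show ?thesis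
      using discharge_max Gmax assms d by (auto simp: feasible_def next_state_def)
  next
    case empty
    then show ?thesis
      using \<alpha>d Gmax assms d by (auto simp: feasible_def next_state_def)
  qed
qed

text \<open>The next state is nonnegative, so storage delivers at most \<open>\<alpha>d * S\<close>
  and generation must cover the rest. The penalty does not depend on the action.\<close>

lemma stage_cost_ge_shortfall:
  assumes "feasible \<alpha>c \<alpha>d Gmax Smax S \<delta> a" "0 \<le> \<rho>1"
  shows "shortfall_cost Gmax \<rho>1 \<rho>2 (- \<delta> - \<alpha>d * S) \<le> stage_cost \<alpha>d Gmax \<rho>1 \<rho>2 S \<delta> a"
proof -
  obtain G C D where a: "a = (G, C, D)"
    using prod_cases3 by blast
  define x where "x = next_state \<alpha>c \<alpha>d S a"
  have F: "0 \<le> x" "0 \<le> G" "\<alpha>d * (x - S) \<le> G + max \<delta> (- Gmax - \<alpha>d * S)"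
    using feasible_bounds[of S \<delta> G C D] assms(1) by (simp_all add: a x_def)
  have "0 \<le> \<alpha>d * x"
    using F(1) \<alpha>d by simp
  then have "min Gmax (max 0 (- \<delta> - \<alpha>d * S)) \<le> G"
    using F by (auto simp: right_diff_distrib min_def max_def split: if_splits)
  then show ?thesis
    using assms(2) by (auto simp: a stage_cost_def shortfall_cost_def intro!: mult_left_mono)
qed

text \<open>With both thresholds at 0 the rule empties the storage before it generates, which
  attains the lower bound of \<open>stage_cost_ge_shortfall\<close>.\<close>

lemma stage_cost_two_threshold_0:
  assumes "0 \<le> S" "S \<le> Smax"
  shows "stage_cost \<alpha>d Gmax \<rho>1 \<rho>2 S \<delta> (two_threshold \<alpha>c \<alpha>d Gmax Smax 0 0 S \<delta>)
    = shortfall_cost Gmax \<rho>1 \<rho>2 (- \<delta> - \<alpha>d * S)"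
proof -
  have "0 \<le> \<alpha>d * S" "0 \<le> (Smax - S) / \<alpha>c"
    using assms \<alpha>c \<alpha>d by simp_all
  then have "fst (two_threshold \<alpha>c \<alpha>d Gmax Smax 0 0 S \<delta>) = min Gmax (max 0 (- \<delta> - \<alpha>d * S))"
    using assms Gmax by (auto simp: two_threshold_def)
  then show ?thesis
    by (auto simp: stage_cost_def shortfall_cost_def split: prod.splits)
qed

end

section \<open>Optimality of the thresholds against a convex value function\<close>

locale storage_value = storage \<alpha>c \<alpha>d Gmax Smax + convex_value V Smax
  for \<alpha>c \<alpha>d Gmax Smax V +
  fixes \<rho>1 :: real
  assumes \<rho>1: "0 \<le> \<rho>1"
begin

text \<open>Storing one unit by generation costs \<open>\<rho>1 / \<alpha>c\<close>; releasing one
  stored unit saves \<open>\<rho>1 * \<alpha>d\<close>. The round-trip loss makes the first price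
  the higher one, which orders the thresholds.\<close>

definition "Sc = threshold (\<rho>1 / \<alpha>c)"
definition "Sd = threshold (\<rho>1 * \<alpha>d)"

lemma Sc_le_Sd: "Sc \<le> Sd"
proof -
  have "\<alpha>d \<le> 1 / \<alpha>c"
    using \<alpha>c \<alpha>d by (simp add: pos_le_divide_eq mult_le_one)
  then have "\<rho>1 * \<alpha>d \<le> \<rho>1 / \<alpha>c"
    using mult_left_mono[OF _ \<rho>1] by fastforce
  then show ?thesis
    unfolding Sc_def Sd_def by (rule threshold_antimono)
qed

text \<open>A competing action enters only through its generation \<open>G\<close> and the state
  \<open>x\<close> it reaches. The state \<open>y\<close> reached by the rule either is at least
  \<open>x\<close> and needs no generation (\<open>free\<close>), or lies between \<open>x\<close>
  and a threshold (\<open>up\<close>, \<open>down\<close>), except when shortage leaves no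
  choice.\<close>

lemma two_threshold_greedy:
  assumes S: "0 \<le> S" "S \<le> Smax" and feas: "feasible \<alpha>c \<alpha>d Gmax Smax S \<delta> a"
  defines "t \<equiv> two_threshold \<alpha>c \<alpha>d Gmax Smax Sc Sd S \<delta>"
  shows "\<rho>1 * fst t + V (next_state \<alpha>c \<alpha>d S t) \<le> \<rho>1 * fst a + V (next_state \<alpha>c \<alpha>d S a)"
proof -
  obtain G C D where a: "a = (G, C, D)"
    using prod_cases3 by blast
  define x where "x = next_state \<alpha>c \<alpha>d S a"
  have F: "0 \<le> x" "x \<le> Smax" "0 \<le> G" "G \<le> Gmax"
    and m: "\<alpha>d * (x - S) \<le> G + max \<delta> (- Gmax - \<alpha>d * S)" "(x - S) / \<alpha>c \<le> G + max \<delta> (- Gmax - \<alpha>d * S)"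
    using feasible_bounds[of S \<delta> G C D] feas by (simp_all add: a x_def)
  have thr: "0 \<le> Sc" "Sc \<le> Sd" "Sd \<le> Smax"
    using Sc_le_Sd threshold_nonneg threshold_le by (simp_all add: Sc_def Sd_def)
  have d: "0 \<le> \<alpha>d * S" "\<alpha>d * (S - Sd) \<le> \<alpha>d * S"
    using \<alpha>d S thr by (auto intro: mult_left_mono)
  have free: "\<rho>1 * 0 + V y \<le> \<rho>1 * G + V x" if "x \<le> y" for y
    using antimono[of x y] F \<rho>1 that by (simp add: add_increasing)
  \<comment> \<open>Here \<open>(y - S) / \<alpha>c - \<delta>\<close> is the generation needed to
    charge exactly to \<open>y\<close>. The condition on \<delta> makes the maximum in the balance
    equal to \<delta>.\<close>
  have up: "\<rho>1 * ((y - S) / \<alpha>c - \<delta>) + V y \<le> \<rho>1 * G + V x"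
    if "- Gmax - \<alpha>d * S \<le> \<delta>" "Sc \<le> y \<and> y \<le> x \<or> x \<le> y \<and> y \<le> Sc" for y
  proof -
    have "\<rho>1 / \<alpha>c * y + V y \<le> \<rho>1 / \<alpha>c * x + V x"
      using that(2) F threshold_right[of "\<rho>1 / \<alpha>c" y x] threshold_left[of x y "\<rho>1 / \<alpha>c"]
      by (auto simp: Sc_def)
    moreover have "\<rho>1 * ((x - S) / \<alpha>c - \<delta>) \<le> \<rho>1 * G"
      using m(2) that(1) by (intro mult_left_mono \<rho>1) auto
    ultimately show ?thesis
      by (simp add: diff_divide_distrib right_diff_distrib)
  qed
  have down: "\<rho>1 * (\<alpha>d * (y - S) - \<delta>) + V y \<le> \<rho>1 * G + V x"
    if "- Gmax - \<alpha>d * S \<le> \<delta>" "Sd \<le> y \<and> y \<le> x \<or> x \<le> y \<and> y \<le> Sd" for y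
  proof -
    have "\<rho>1 * \<alpha>d * y + V y \<le> \<rho>1 * \<alpha>d * x + V x"
      using that(2) F threshold_right[of "\<rho>1 * \<alpha>d" y x] threshold_left[of x y "\<rho>1 * \<alpha>d"]
      by (auto simp: Sd_def)
    moreover have "\<rho>1 * (\<alpha>d * (x - S) - \<delta>) \<le> \<rho>1 * G"
      using m(1) that(1) by (intro mult_left_mono \<rho>1) auto
    ultimately show ?thesis
      by (simp add: right_diff_distrib mult.assoc)
  qed
  have "\<rho>1 * fst t + V (next_state \<alpha>c \<alpha>d S t) \<le> \<rho>1 * G + V x"
    using thr(2,3) S
  proof (cases rule: two_threshold_cases[where Sc = Sc and Sd = Sd and S = S and \<delta> = \<delta>])
    case full
    then show ?thesis
      using \<alpha>c free[of Smax] F by (simp add: t_def next_state_def)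
  next
    case surplus
    define y where "y = S + \<alpha>c * \<delta>"
    have "Sc \<le> y" and eq: "(y - S) / \<alpha>c - \<delta> = 0"
      using surplus(3) \<alpha>c by (simp_all add: y_def field_simps)
    \<comment> \<open>Either \<open>x \<le> y\<close> and \<open>free\<close> applies, or
      \<open>Sc \<le> y \<le> x\<close> and \<open>up\<close> applies with zero generation.\<close>
    then have "\<rho>1 * 0 + V y \<le> \<rho>1 * G + V x"
      using up[of y] free[of y] surplus(2) d Gmax unfolding eq by linarith
    then show ?thesis
      using surplus(1) by (simp add: t_def next_state_def y_def)
  next
    case charge
    then have "- Gmax - \<alpha>d * S \<le> \<delta>"
      using d \<alpha>c by (smt (verit) divide_pos_pos)
    then show ?thesis
      using up[of Sc] charge(1) \<alpha>c by (simp add: t_def next_state_def linear)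
  next
    case charge_max
    define y where "y = S + \<alpha>c * (Gmax + \<delta>)"
    \<comment> \<open>No feasible action gets above \<open>y\<close>, the state reached at full
      generation, and \<open>y\<close> is still below \<open>Sc\<close>.\<close>
    have "(x - S) / \<alpha>c \<le> Gmax + \<delta>"
      using m(2) F charge_max(2) d by simp
    then have "x \<le> y" "y \<le> Sc" and eq: "(y - S) / \<alpha>c - \<delta> = Gmax"
      using charge_max(3) \<alpha>c by (simp_all add: y_def field_simps)
    then show ?thesis
      using up[of y] charge_max(1,2) d by (simp add: t_def next_state_def y_def)
  next
    case hold
    \<comment> \<open>Staying at \<open>S\<close> beats any \<open>x \<ge> S\<close> by
      \<open>up\<close> and any \<open>x \<le> S\<close> by \<open>down\<close>, as \<open>S\<close>
      lies between the thresholds.\<close>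
    then show ?thesis
      using up[of S] down[of S] d by (simp add: t_def next_state_def) linarith
  next
    case cover
    define y where "y = S + \<delta> / \<alpha>d"
    have "Sd \<le> y" and eq: "\<alpha>d * (y - S) - \<delta> = 0"
      using cover(2) \<alpha>d by (simp_all add: y_def field_simps)
    then have "\<rho>1 * 0 + V y \<le> \<rho>1 * G + V x"
      using down[of y] free[of y] cover(2) d Gmax unfolding eq by linarith
    then show ?thesis
      using cover(1) by (simp add: t_def next_state_def y_def)
  next
    case discharge
    then have t: "t = (\<alpha>d * (Sd - S) - \<delta>, 0, \<alpha>d * (S - Sd))"
      by (simp add: t_def right_diff_distrib)
    have "- Gmax - \<alpha>d * S \<le> \<delta>"
      using discharge d by simp
    then show ?thesis
      using down[of Sd] t \<alpha>d by (simp add: next_state_def linear)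
  next
    case discharge_max
    define y where "y = S + (Gmax + \<delta>) / \<alpha>d"
    have "\<alpha>d * (x - S) \<le> Gmax + \<delta>"
      using m(1) F discharge_max(2) by simp
    then have "x \<le> y" "y \<le> Sd" and eq: "\<alpha>d * (y - S) - \<delta> = Gmax"
      using discharge_max(4) \<alpha>d by (simp_all add: y_def field_simps)
    moreover have "next_state \<alpha>c \<alpha>d S (Gmax, 0, - Gmax - \<delta>) = y"
      using \<alpha>d by (simp add: t_def next_state_def y_def field_simps)
    ultimately show ?thesis
      using down[of y] discharge_max(1,2) by (simp add: t_def)
  next
    case empty
    \<comment> \<open>Shortage forces full generation and empty storage, so every feasible action
      ties with the rule.\<close>
    then have "\<alpha>d * x \<le> G - Gmax"
      using m(1) by (simp add: right_diff_distrib)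
    moreover have "0 \<le> \<alpha>d * x"
      using F(1) \<alpha>d by simp
    ultimately have "G = Gmax" "\<alpha>d * x = 0"
      using F(4) by linarith+
    then have "G = Gmax" "x = 0"
      using \<alpha>d(1) by simp_all
    then show ?thesis
      using empty(1) \<alpha>d by (simp add: t_def next_state_def)
  qed
  then show ?thesis
    by (simp add: a x_def)
qed

end

section \<open>Fubini for independent variables, and measurability\<close>

text \<open>Independence makes the joint law a product, so the first variable can be frozen. This
  takes the place of conditioning on the first slot.\<close>

lemma (in prob_space) expectation_indep_pair:
  fixes g :: "real \<times> real \<Rightarrow> real"
  assumes indep: "indep_var borel X borel Y"
    and [measurable]: "g \<in> borel_measurable borel" and B: "\<And>z. \<bar>g z\<bar> \<le> B"
  shows "expectation (\<lambda>\<omega>. g (X \<omega>, Y \<omega>)) = expectation (\<lambda>\<omega>. expectation (\<lambda>\<omega>'. g (X \<omega>, Y \<omega>')))"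
    and "integrable M (\<lambda>\<omega>. expectation (\<lambda>\<omega>'. g (X \<omega>, Y \<omega>')))"
proof -
  have X [measurable]: "random_variable borel X" and Y [measurable]: "random_variable borel Y"
    using indep_var_rv1[OF indep] indep_var_rv2[OF indep] by auto
  interpret X: prob_space "distr M borel X"
    by (rule prob_space_distr) simp
  interpret Y: prob_space "distr M borel Y"
    by (rule prob_space_distr) simp
  interpret XY: pair_prob_space "distr M borel X" "distr M borel Y" ..
  have g [measurable]: "g \<in> borel_measurable (borel \<Otimes>\<^sub>M borel)"
    by (simp add: borel_prod)
  have int: "integrable (distr M borel X \<Otimes>\<^sub>M distr M borel Y) g"
    by (rule XY.P.integrable_const_bound[where B = B]) (use B in auto)
  have inner: "(LINT y|distr M borel Y. g (x, y)) = expectation (\<lambda>\<omega>'. g (x, Y \<omega>'))" for x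
    by (subst integral_distr) auto
  have "expectation (\<lambda>\<omega>. g (X \<omega>, Y \<omega>)) = integral\<^sup>L (distr M (borel \<Otimes>\<^sub>M borel) (\<lambda>\<omega>. (X \<omega>, Y \<omega>))) g"
    by (subst integral_distr) auto
  also have "\<dots> = (LINT x|distr M borel X. LINT y|distr M borel Y. g (x, y))"
    unfolding indep_var_distribution_eq[THEN iffD1, OF indep, THEN conjunct2, THEN conjunct2, symmetric]
    by (rule XY.integral_fst'[OF int, symmetric])
  also have "\<dots> = expectation (\<lambda>\<omega>. LINT y|distr M borel Y. g (X \<omega>, y))"
    by (subst integral_distr) auto
  finally show "expectation (\<lambda>\<omega>. g (X \<omega>, Y \<omega>)) = expectation (\<lambda>\<omega>. expectation (\<lambda>\<omega>'. g (X \<omega>, Y \<omega>')))"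
    by (simp add: inner)
  have "integrable M (\<lambda>\<omega>. LINT y|distr M borel Y. g (X \<omega>, y))"
    using XY.integrable_fst'[OF int] by (subst (asm) integrable_distr_eq) auto
  then show "integrable M (\<lambda>\<omega>. expectation (\<lambda>\<omega>'. g (X \<omega>, Y \<omega>')))"
    by (simp add: inner)
qed

text \<open>\<open>admissible\<close> uses \<open>borel\<close> on nested product types, so
  projections must be measurable for that sigma-algebra; continuity provides this.\<close>

lemma borel_measurable_fst_comp [measurable (raw)]:
  fixes f :: "'a \<Rightarrow> 'b::second_countable_topology \<times> 'c::second_countable_topology"
  shows "f \<in> borel_measurable N \<Longrightarrow> (\<lambda>x. fst (f x)) \<in> borel_measurable N"
  by (rule measurable_compose[OF _ borel_measurable_continuous_onI]) (auto intro: continuous_intros)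

lemma borel_measurable_snd_comp [measurable (raw)]:
  fixes f :: "'a \<Rightarrow> 'b::second_countable_topology \<times> 'c::second_countable_topology"
  shows "f \<in> borel_measurable N \<Longrightarrow> (\<lambda>x. snd (f x)) \<in> borel_measurable N"
  by (rule measurable_compose[OF _ borel_measurable_continuous_onI]) (auto intro: continuous_intros)

lemma next_state_measurable [measurable (raw)]:
  assumes [measurable]: "S \<in> borel_measurable N" "a \<in> borel_measurable N"
  shows "(\<lambda>x. next_state \<alpha>c \<alpha>d (S x) (a x)) \<in> borel_measurable N"
  unfolding next_state_def split_beta by measurable

lemma stage_cost_measurable [measurable (raw)]:
  assumes [measurable]: "S \<in> borel_measurable N" "\<delta> \<in> borel_measurable N" "a \<in> borel_measurable N"
  shows "(\<lambda>x. stage_cost \<alpha>d Gmax \<rho>1 \<rho>2 (S x) (\<delta> x) (a x)) \<in> borel_measurable N"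
  unfolding stage_cost_def split_beta by measurable

lemma two_threshold_measurable [measurable (raw)]:
  assumes [measurable]: "S \<in> borel_measurable N" "\<delta> \<in> borel_measurable N"
  shows "(\<lambda>x. two_threshold \<alpha>c \<alpha>d Gmax Smax Sc Sd (S x) (\<delta> x)) \<in> borel_measurable N"
  unfolding two_threshold_def by measurable

lemma (in storage) stage_cost_bound:
  assumes "feasible \<alpha>c \<alpha>d Gmax Smax S \<delta> a" "0 \<le> \<rho>1" "0 \<le> \<rho>2"
  shows "\<bar>stage_cost \<alpha>d Gmax \<rho>1 \<rho>2 S \<delta> a\<bar> \<le> \<rho>1 * Gmax + \<rho>2"
  using assms mult_left_mono[of "fst a" Gmax \<rho>1] by (auto simp: feasible_def stage_cost_def)

section \<open>The two-slot problem\<close>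

locale two_slot = storage \<alpha>c \<alpha>d Gmax Smax + prob_space M
  for \<alpha>c \<alpha>d Gmax Smax and M :: "'a measure" +
  fixes S1 \<rho>1 \<rho>2 :: real and \<Delta> :: "nat \<Rightarrow> 'a \<Rightarrow> real"
  assumes S1: "0 \<le> S1" "S1 \<le> Smax" and \<rho>1: "0 \<le> \<rho>1" and \<rho>2: "0 \<le> \<rho>2"
    and indep: "indep_var borel (\<Delta> 1) borel (\<Delta> 2)"
begin

lemma \<Delta>_measurable [measurable]: "\<Delta> 1 \<in> borel_measurable M" "\<Delta> 2 \<in> borel_measurable M"
  using indep_var_rv1[OF indep] indep_var_rv2[OF indep] by auto

definition V :: "real \<Rightarrow> real" where
  "V S = expectation (\<lambda>\<omega>. shortfall_cost Gmax \<rho>1 \<rho>2 (- \<Delta> 2 \<omega> - \<alpha>d * S))"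

text \<open>The second slot is replaced by its least expected cost. What remains depends on the
  first outcome alone, so policies can be compared outcome by outcome.\<close>

definition cost_to_go :: "policy \<Rightarrow> 'a \<Rightarrow> real" where
  "cost_to_go \<pi> \<omega> = stage_cost \<alpha>d Gmax \<rho>1 \<rho>2 S1 (\<Delta> 1 \<omega>) (action1 \<pi> S1 (\<Delta> 1 \<omega>))
     + V (state2 \<alpha>c \<alpha>d \<pi> S1 (\<Delta> 1 \<omega>))"

lemma shortfall_cost_integrable:
  assumes [measurable]: "Y \<in> borel_measurable M"
  shows "integrable M (\<lambda>\<omega>. shortfall_cost Gmax \<rho>1 \<rho>2 (Y \<omega>))"
proof (rule integrable_const_bound)
  show "AE \<omega> in M. norm (shortfall_cost Gmax \<rho>1 \<rho>2 (Y \<omega>)) \<le> \<rho>1 * Gmax + \<rho>2"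
    using shortfall_cost_nonneg[OF Gmax \<rho>1 \<rho>2] shortfall_cost_le[OF Gmax \<rho>1 \<rho>2] by simp
qed simp

text \<open>Given the first outcome, the expected second cost is at least \<open>V\<close> of the
  state reached, with equality if the second rule attains the shortfall bound.\<close>

lemma expected_cost:
  assumes "admissible \<alpha>c \<alpha>d Gmax Smax S1 M \<Delta> \<pi>"
  shows cost_to_go_integrable: "integrable M (cost_to_go \<pi>)"
    and expected_cost_ge: "expectation (cost_to_go \<pi>) \<le> expected_cost \<alpha>c \<alpha>d Gmax \<rho>1 \<rho>2 S1 M \<Delta> \<pi>"
    and expected_cost_eq: "(\<And>S \<delta> p. 0 \<le> S \<Longrightarrow> S \<le> Smax \<Longrightarrow>
        stage_cost \<alpha>d Gmax \<rho>1 \<rho>2 S \<delta> (snd \<pi> (p, S, \<delta>)) = shortfall_cost Gmax \<rho>1 \<rho>2 (- \<delta> - \<alpha>d * S)) \<Longrightarrow>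
      expected_cost \<alpha>c \<alpha>d Gmax \<rho>1 \<rho>2 S1 M \<Delta> \<pi> = expectation (cost_to_go \<pi>)"
proof -
  have \<pi>: "fst \<pi> \<in> borel_measurable borel" "snd \<pi> \<in> borel_measurable borel"
    and feas1: "\<And>\<omega>. \<omega> \<in> space M \<Longrightarrow> feasible \<alpha>c \<alpha>d Gmax Smax S1 (\<Delta> 1 \<omega>) (action1 \<pi> S1 (\<Delta> 1 \<omega>))"
    and feas2: "\<And>\<omega>. \<omega> \<in> space M \<Longrightarrow> feasible \<alpha>c \<alpha>d Gmax Smax (state2 \<alpha>c \<alpha>d \<pi> S1 (\<Delta> 1 \<omega>)) (\<Delta> 2 \<omega>)
          (action2 \<alpha>c \<alpha>d \<pi> S1 (\<Delta> 1 \<omega>) (\<Delta> 2 \<omega>))"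
    using assms by (auto simp: admissible_def)
  have a1 [measurable]: "action1 \<pi> S1 \<in> borel_measurable borel"
    unfolding action1_def by (rule measurable_compose[OF _ \<pi>(1)]) measurable
  have s2 [measurable]: "state2 \<alpha>c \<alpha>d \<pi> S1 \<in> borel_measurable borel"
    unfolding state2_def by measurable
  have [measurable]: "(\<lambda>\<omega>. action2 \<alpha>c \<alpha>d \<pi> S1 (\<Delta> 1 \<omega>) (\<Delta> 2 \<omega>)) \<in> borel_measurable M"
    unfolding action2_def by (rule measurable_compose[OF _ \<pi>(2)]) measurable
  define c1 where "c1 = (\<lambda>\<omega>. stage_cost \<alpha>d Gmax \<rho>1 \<rho>2 S1 (\<Delta> 1 \<omega>) (action1 \<pi> S1 (\<Delta> 1 \<omega>)))"
  define c2 where "c2 = (\<lambda>\<omega>. stage_cost \<alpha>d Gmax \<rho>1 \<rho>2 (state2 \<alpha>c \<alpha>d \<pi> S1 (\<Delta> 1 \<omega>)) (\<Delta> 2 \<omega>)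
       (action2 \<alpha>c \<alpha>d \<pi> S1 (\<Delta> 1 \<omega>) (\<Delta> 2 \<omega>)))"
  \<comment> \<open>The lower bound on the second cost as a function of both outcomes; the state
    depends on the first one only.\<close>
  define g where "g = (\<lambda>z. shortfall_cost Gmax \<rho>1 \<rho>2 (- snd z - \<alpha>d * state2 \<alpha>c \<alpha>d \<pi> S1 (fst z)))"
  have g [measurable]: "g \<in> borel_measurable borel" and g_bound: "\<bar>g z\<bar> \<le> \<rho>1 * Gmax + \<rho>2" for z
    unfolding g_def
    using shortfall_cost_nonneg[OF Gmax \<rho>1 \<rho>2] shortfall_cost_le[OF Gmax \<rho>1 \<rho>2]
    by (measurable, simp)
  have c1: "integrable M c1"
  proof (rule integrable_const_bound)
    show "AE \<omega> in M. norm (c1 \<omega>) \<le> \<rho>1 * Gmax + \<rho>2"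
      using stage_cost_bound[OF feas1 \<rho>1 \<rho>2] by (simp add: c1_def)
  qed (unfold c1_def, measurable)
  have c2: "integrable M c2"
  proof (rule integrable_const_bound)
    show "AE \<omega> in M. norm (c2 \<omega>) \<le> \<rho>1 * Gmax + \<rho>2"
      using stage_cost_bound[OF feas2 \<rho>1 \<rho>2] by (simp add: c2_def)
  qed (unfold c2_def, measurable)
  have V_eq: "V (state2 \<alpha>c \<alpha>d \<pi> S1 (\<Delta> 1 \<omega>)) = expectation (\<lambda>\<omega>'. g (\<Delta> 1 \<omega>, \<Delta> 2 \<omega>'))" for \<omega>
    by (simp add: V_def g_def)
  note fubini = expectation_indep_pair[OF indep g g_bound]
  have g_int: "integrable M (\<lambda>\<omega>. g (\<Delta> 1 \<omega>, \<Delta> 2 \<omega>))"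
    unfolding g_def fst_conv snd_conv by (rule shortfall_cost_integrable) measurable
  have ctg: "cost_to_go \<pi> = (\<lambda>\<omega>. c1 \<omega> + expectation (\<lambda>\<omega>'. g (\<Delta> 1 \<omega>, \<Delta> 2 \<omega>')))"
    unfolding fun_eq_iff cost_to_go_def c1_def V_eq by blast
  show "integrable M (cost_to_go \<pi>)"
    unfolding ctg using c1 fubini(2) by (rule Bochner_Integration.integrable_add)
  have E: "expectation (cost_to_go \<pi>) = expectation (\<lambda>\<omega>. c1 \<omega> + g (\<Delta> 1 \<omega>, \<Delta> 2 \<omega>))"
    unfolding ctg using c1 fubini g_int by simp
  have cost: "expected_cost \<alpha>c \<alpha>d Gmax \<rho>1 \<rho>2 S1 M \<Delta> \<pi> = expectation (\<lambda>\<omega>. c1 \<omega> + c2 \<omega>)"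
    by (simp add: expected_cost_def c1_def c2_def)
  show "expectation (cost_to_go \<pi>) \<le> expected_cost \<alpha>c \<alpha>d Gmax \<rho>1 \<rho>2 S1 M \<Delta> \<pi>"
    unfolding E cost
  proof (rule integral_mono)
    fix \<omega> assume "\<omega> \<in> space M"
    then show "c1 \<omega> + g (\<Delta> 1 \<omega>, \<Delta> 2 \<omega>) \<le> c1 \<omega> + c2 \<omega>"
      using stage_cost_ge_shortfall[OF feas2 \<rho>1] by (simp add: g_def c2_def)
  qed (use c1 c2 g_int in auto)
  show "expected_cost \<alpha>c \<alpha>d Gmax \<rho>1 \<rho>2 S1 M \<Delta> \<pi> = expectation (cost_to_go \<pi>)"
    if "\<And>S \<delta> p. 0 \<le> S \<Longrightarrow> S \<le> Smax \<Longrightarrow>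
        stage_cost \<alpha>d Gmax \<rho>1 \<rho>2 S \<delta> (snd \<pi> (p, S, \<delta>)) = shortfall_cost Gmax \<rho>1 \<rho>2 (- \<delta> - \<alpha>d * S)"
    unfolding E cost
  proof (rule Bochner_Integration.integral_cong)
    fix \<omega> assume "\<omega> \<in> space M"
    then have "0 \<le> state2 \<alpha>c \<alpha>d \<pi> S1 (\<Delta> 1 \<omega>)" "state2 \<alpha>c \<alpha>d \<pi> S1 (\<Delta> 1 \<omega>) \<le> Smax"
      using feas2 by (force simp: feasible_def)+
    then show "c1 \<omega> + c2 \<omega> = c1 \<omega> + g (\<Delta> 1 \<omega>, \<Delta> 2 \<omega>)"
      using that by (simp add: g_def c2_def action2_def)
  qed simp
qed

lemma two_threshold_policy_admissible:
  assumes "\<And>i. i \<in> {1, 2} \<Longrightarrow> 0 \<le> Sc i \<and> Sc i \<le> Sd i \<and> Sd i \<le> Smax"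
  shows "admissible \<alpha>c \<alpha>d Gmax Smax S1 M \<Delta> (two_threshold_policy \<alpha>c \<alpha>d Gmax Smax Sc Sd)"
proof -
  have 1: "feasible \<alpha>c \<alpha>d Gmax Smax S1 \<delta> (two_threshold \<alpha>c \<alpha>d Gmax Smax (Sc 1) (Sd 1) S1 \<delta>)" for \<delta>
    using assms[of 1] S1 by (intro two_threshold_feasible) auto
  have 2: "feasible \<alpha>c \<alpha>d Gmax Smax S \<delta> (two_threshold \<alpha>c \<alpha>d Gmax Smax (Sc 2) (Sd 2) S \<delta>)"
    if "0 \<le> S" "S \<le> Smax" for S \<delta>
    using assms[of 2] that by (intro two_threshold_feasible) auto
  have "0 \<le> next_state \<alpha>c \<alpha>d S1 (two_threshold \<alpha>c \<alpha>d Gmax Smax (Sc 1) (Sd 1) S1 \<delta>)"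
    "next_state \<alpha>c \<alpha>d S1 (two_threshold \<alpha>c \<alpha>d Gmax Smax (Sc 1) (Sd 1) S1 \<delta>) \<le> Smax" for \<delta>
    using 1[of \<delta>] by (auto simp: feasible_def)
  then show ?thesis
    using 1 2 unfolding admissible_def two_threshold_policy_def split_beta
    by (simp add: action1_def action2_def state2_def)
qed

lemma ex_optimal_two_threshold:
  assumes "convex_value V Smax"
  shows "\<exists>Sc Sd :: nat \<Rightarrow> real.
    (\<forall>i\<in>{1, 2}. 0 \<le> Sc i \<and> Sc i \<le> Sd i \<and> Sd i \<le> Smax) \<and>
    optimal \<alpha>c \<alpha>d Gmax Smax \<rho>1 \<rho>2 S1 M \<Delta> (two_threshold_policy \<alpha>c \<alpha>d Gmax Smax Sc Sd)"
proof -
  interpret convex_value V Smax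
    by fact
  interpret val: storage_value \<alpha>c \<alpha>d Gmax Smax V \<rho>1
    by unfold_locales (rule \<rho>1)
  \<comment> \<open>Stored power has no use after the second slot, hence zero thresholds
    there.\<close>
  define Sc where "Sc i = (if i = 1 then val.Sc else 0)" for i :: nat
  define Sd where "Sd i = (if i = 1 then val.Sd else 0)" for i :: nat
  define \<pi> where "\<pi> = two_threshold_policy \<alpha>c \<alpha>d Gmax Smax Sc Sd"
  have thr: "0 \<le> Sc i \<and> Sc i \<le> Sd i \<and> Sd i \<le> Smax" for i
    using val.Sc_le_Sd threshold_nonneg threshold_le X_nonneg
    by (simp add: Sc_def Sd_def val.Sc_def val.Sd_def)
  have adm: "admissible \<alpha>c \<alpha>d Gmax Smax S1 M \<Delta> \<pi>"
    unfolding \<pi>_def by (rule two_threshold_policy_admissible) (rule thr)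
  have "expected_cost \<alpha>c \<alpha>d Gmax \<rho>1 \<rho>2 S1 M \<Delta> \<pi> \<le> expected_cost \<alpha>c \<alpha>d Gmax \<rho>1 \<rho>2 S1 M \<Delta> \<pi>'"
    if adm': "admissible \<alpha>c \<alpha>d Gmax Smax S1 M \<Delta> \<pi>'" for \<pi>'
  proof -
    have "expected_cost \<alpha>c \<alpha>d Gmax \<rho>1 \<rho>2 S1 M \<Delta> \<pi> = expectation (cost_to_go \<pi>)"
      by (rule expected_cost_eq[OF adm])
        (simp add: \<pi>_def two_threshold_policy_def Sc_def Sd_def stage_cost_two_threshold_0)
    also have "\<dots> \<le> expectation (cost_to_go \<pi>')"
    proof (rule integral_mono[OF cost_to_go_integrable[OF adm] cost_to_go_integrable[OF adm']])
      fix \<omega> assume "\<omega> \<in> space M"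
      then have feas: "feasible \<alpha>c \<alpha>d Gmax Smax S1 (\<Delta> 1 \<omega>) (action1 \<pi>' S1 (\<Delta> 1 \<omega>))"
        using adm' by (simp add: admissible_def)
      have "action1 \<pi> S1 \<delta> = two_threshold \<alpha>c \<alpha>d Gmax Smax val.Sc val.Sd S1 \<delta>" for \<delta>
        by (simp add: action1_def \<pi>_def two_threshold_policy_def Sc_def Sd_def)
      \<comment> \<open>The first-slot penalty is the same for both policies and cancels.\<close>
      then show "cost_to_go \<pi> \<omega> \<le> cost_to_go \<pi>' \<omega>"
        using val.two_threshold_greedy[OF S1 feas]
        by (simp add: cost_to_go_def stage_cost_def state2_def split_beta)
    qed
    also have "\<dots> \<le> expected_cost \<alpha>c \<alpha>d Gmax \<rho>1 \<rho>2 S1 M \<Delta> \<pi>'"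
      by (rule expected_cost_ge[OF adm'])
    finally show ?thesis .
  qed
  then show ?thesis
    using thr adm unfolding optimal_def \<pi>_def by blast
qed

lemma convex_value_V:
  assumes f_nonneg: "\<And>x. 0 \<le> f x"
    and pdf: "distributed M lborel (\<Delta> 2) (\<lambda>x. ennreal (f x))"
    and f_mono: "mono_on {..0} f"
  shows "convex_value V Smax"
proof -
  let ?\<phi> = "shortfall_cost Gmax \<rho>1 \<rho>2"
  have [measurable]: "f \<in> borel_measurable borel"
    using distributed_real_measurable[OF _ pdf] f_nonneg by simp
  \<comment> \<open>Integrability of \<open>f\<close> is that of the constant 1 under the law of
    \<open>\<Delta> 2\<close>.\<close>
  have "integrable lborel (\<lambda>x. f x * 1) \<longleftrightarrow> integrable M (\<lambda>x. 1::real)"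
    by (rule distributed_integrable[OF pdf]) (use f_nonneg in auto)
  then have f_int: "integrable lborel f"
    by simp
  have V_density: "V S = (LINT x|lborel. f x * ?\<phi> (- x - \<alpha>d * S))" for S
    unfolding V_def by (rule distributed_integral[OF pdf, symmetric]) (use f_nonneg in auto)
  show ?thesis
  proof
    show "V t \<le> V s" if "0 \<le> s" "s \<le> t" for s t
      unfolding V_def
      using shortfall_cost_mono[OF Gmax \<rho>1 \<rho>2] that \<alpha>d
      by (intro integral_mono shortfall_cost_integrable) (auto intro: monoD)
    show "V t - V (t + h) \<le> V s - V (s + h)" if "0 \<le> s" "s \<le> t" "0 \<le> h" for s t h
      \<comment> \<open>Distributing \<alpha>d turns a step \<open>h\<close> in storage into a step
        \<open>\<alpha>d * h\<close> in the shortage.\<close>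
      unfolding V_density distrib_left
    proof (rule increment_integral_antimono[OF f_int f_nonneg f_mono])
      show "mono ?\<phi>"
        by (rule shortfall_cost_mono[OF Gmax \<rho>1 \<rho>2])
      show "?\<phi> y = 0" if "y \<le> 0" for y
        using shortfall_cost_eq_0[OF Gmax \<rho>1 \<rho>2 that] .
      show "\<bar>?\<phi> y\<bar> \<le> \<rho>1 * Gmax + \<rho>2" for y
        using shortfall_cost_nonneg[OF Gmax \<rho>1 \<rho>2] shortfall_cost_le[OF Gmax \<rho>1 \<rho>2] by simp
    qed (use that \<alpha>d in auto)
    show "(\<lambda>n. V (1 / Suc n)) \<longlonglongrightarrow> V 0"
      unfolding V_def
    proof (rule integral_dominated_convergence[where w = "\<lambda>_. \<rho>1 * Gmax + \<rho>2"])
      have "(\<lambda>n. ?\<phi> (- \<Delta> 2 \<omega> - \<alpha>d * (1 / Suc n))) \<longlonglongrightarrow> ?\<phi> (- \<Delta> 2 \<omega> - \<alpha>d * 0)" for \<omega>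
      proof (rule shortfall_cost_left_continuous[OF Gmax \<rho>1 \<rho>2])
        show "(\<lambda>n. - \<Delta> 2 \<omega> - \<alpha>d * (1 / Suc n)) \<longlonglongrightarrow> - \<Delta> 2 \<omega> - \<alpha>d * 0"
          using LIMSEQ_inverse_real_of_nat by (intro tendsto_intros) (simp add: inverse_eq_divide)
      qed (use \<alpha>d in auto)
      then show "AE \<omega> in M. (\<lambda>n. ?\<phi> (- \<Delta> 2 \<omega> - \<alpha>d * (1 / Suc n))) \<longlonglongrightarrow> ?\<phi> (- \<Delta> 2 \<omega> - \<alpha>d * 0)"
        by simp
      show "AE \<omega> in M. norm (?\<phi> (- \<Delta> 2 \<omega> - \<alpha>d * (1 / Suc n))) \<le> \<rho>1 * Gmax + \<rho>2" for n
        using shortfall_cost_nonneg[OF Gmax \<rho>1 \<rho>2] shortfall_cost_le[OF Gmax \<rho>1 \<rho>2] by simp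
    qed simp_all
    show "0 \<le> Smax"
      using S1 by simp
  qed
qed

end

theorem proposition7:
  fixes \<alpha>c \<alpha>d Gmax Smax S1 \<rho>1 \<rho>2 :: real
    and M :: "'a measure" and \<Delta> :: "nat \<Rightarrow> 'a \<Rightarrow> real" and f :: "real \<Rightarrow> real"
  assumes "0 < \<alpha>c" "\<alpha>c < 1" "0 < \<alpha>d" "\<alpha>d < 1"
    and "0 \<le> Gmax" "0 \<le> Smax" "0 \<le> S1" "S1 \<le> Smax"
    and "0 \<le> \<rho>1" "0 \<le> \<rho>2"
    and "prob_space M"
    and indep: "prob_space.indep_vars M (\<lambda>_. borel) \<Delta> {1, 2}"
    and f_nonneg: "\<And>x. 0 \<le> f x"
    and pdf: "\<And>i. i \<in> {1, 2} \<Longrightarrow> distributed M lborel (\<Delta> i) (\<lambda>x. ennreal (f x))"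
    and mean: "\<And>i. i \<in> {1, 2} \<Longrightarrow> integrable M (\<Delta> i) \<and> (LINT \<omega>|M. \<Delta> i \<omega>) = 0"
    and variance: "\<And>i. i \<in> {1, 2} \<Longrightarrow> integrable M (\<lambda>\<omega>. (\<Delta> i \<omega>)\<^sup>2)"
    and increasing: "mono_on {..0} f"
  shows "\<exists>Sc Sd :: nat \<Rightarrow> real.
    (\<forall>i\<in>{1, 2}. 0 \<le> Sc i \<and> Sc i \<le> Sd i \<and> Sd i \<le> Smax) \<and>
    optimal \<alpha>c \<alpha>d Gmax Smax \<rho>1 \<rho>2 S1 M \<Delta> (two_threshold_policy \<alpha>c \<alpha>d Gmax Smax Sc Sd)"
proof -
  interpret prob_space M by fact
  have "indep_var borel (\<Delta> 1) borel (\<Delta> 2)"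
    \<comment> \<open>The sum over the singleton \<open>{2}\<close> is \<open>\<Delta> 2\<close>
      itself.\<close>
    using indep_vars_sum[of "{2}" 1 \<Delta>] indep by simp
  then interpret two_slot \<alpha>c \<alpha>d Gmax Smax M S1 \<rho>1 \<rho>2 \<Delta>
    using assms by unfold_locales auto
  show ?thesis
    using convex_value_V[OF f_nonneg pdf increasing] by (intro ex_optimal_two_threshold) simp
qed

end
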